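(* Let $I=[0,1]$ and let $f:I\to I$ be a continuous map such that the induced map $\overline f:\mathcal K(I)\to\mathcal K(I)$ is generically chaotic. Then $f$ is also generically chaotic.
   Context: For a compact metric space $(X,d)$, $\mathcal K(X)$ denotes the set of all non-empty compact subsets of $X$ with the Hausdorff metric $d_H$ (a compact metric space). A continuous map $f:X\to X$ induces the continuous map $\overline f:\mathcal K(X)\to\mathcal K(X)$, $\overline f(K)=f(K)=\{f(x): x\in K\}$. For a continuous map $g:Y\to Y$ of a compact metric space $(Y,\rho)$, let $C(g)$ be the set of Li-Yorke pairs, i.e. pairs $(x,y)\in Y^2$ with $\liminf_{n\to\infty}\rho(g^n(x),g^n(y))=0$ and $\limsup_{n\to\infty}\rho(g^n(x),g^n(y))>0$. The map $g$ is generically chaotic if $C(g)$ is residual in $Y^2$ (i.e. its complement is of first category: a countable union of nowhere dense sets). For $\overline f$ this is applied with $Y=\mathcal K(X)$, $\rho=d_H$. *)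

theory Defs
  imports "HOL-Analysis.Analysis"
begin

section \<open>Category notions in a topological space\<close>

definition nowhere_dense_in :: "'a topology \<Rightarrow> 'a set \<Rightarrow> bool" where
  "nowhere_dense_in X S \<longleftrightarrow> S \<subseteq> topspace X \<and> X interior_of (X closure_of S) = {}"

definition first_category_in :: "'a topology \<Rightarrow> 'a set \<Rightarrow> bool" where
  "first_category_in X S \<longleftrightarrow>
     (\<exists>A :: nat \<Rightarrow> 'a set. (\<forall>n. nowhere_dense_in X (A n)) \<and> S = (\<Union>n. A n))"

definition residual_in :: "'a topology \<Rightarrow> 'a set \<Rightarrow> bool" where
  "residual_in X S \<longleftrightarrow> S \<subseteq> topspace X \<and> first_category_in X (topspace X - S)"


section \<open>Li-Yorke pairs and generic chaos\<close>

text \<open>A metric space is given, as in the locale \<^locale>\<open>Metric_space\<close>, by its carrier \<open>Y\<close> and its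
  distance \<open>d\<close>; only the values of \<open>d\<close> and \<open>g\<close> on \<open>Y\<close> matter when \<open>g\<close> maps \<open>Y\<close> to itself.
  Limits inferior and superior are taken in the extended reals.\<close>

definition Li_Yorke_pairs :: "'a set \<Rightarrow> ('a \<Rightarrow> 'a \<Rightarrow> real) \<Rightarrow> ('a \<Rightarrow> 'a) \<Rightarrow> ('a \<times> 'a) set" where
  "Li_Yorke_pairs Y d g =
     {(x, y) \<in> Y \<times> Y.
        liminf (\<lambda>n. ereal (d ((g ^^ n) x) ((g ^^ n) y))) = 0 \<and>
        limsup (\<lambda>n. ereal (d ((g ^^ n) x) ((g ^^ n) y))) > 0}"

definition generically_chaotic :: "'a set \<Rightarrow> ('a \<Rightarrow> 'a \<Rightarrow> real) \<Rightarrow> ('a \<Rightarrow> 'a) \<Rightarrow> bool" where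
  "generically_chaotic Y d g \<longleftrightarrow>
     residual_in (prod_topology (Metric_space.mtopology Y d) (Metric_space.mtopology Y d))
       (Li_Yorke_pairs Y d g)"


section \<open>The hyperspace of non-empty compact subsets\<close>

definition compact_hyperspace :: "'a::metric_space set \<Rightarrow> 'a set set" where
  "compact_hyperspace X = {K. K \<noteq> {} \<and> compact K \<and> K \<subseteq> X}"

text \<open>The value 0 outside the non-empty bounded sets is a convention; it makes the distance total,
  non-negative and symmetric, as \<^locale>\<open>Metric_space\<close> requires also outside the carrier.\<close>

definition hausdorff_dist :: "'a::metric_space set \<Rightarrow> 'a set \<Rightarrow> real" where
  "hausdorff_dist A B =
     (if A = {} \<or> B = {} \<or> \<not> bounded A \<or> \<not> bounded B then 0
      else max (SUP a\<in>A. infdist a B) (SUP b\<in>B. infdist b A))"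

definition induced_map :: "('a \<Rightarrow> 'b) \<Rightarrow> 'a set \<Rightarrow> 'b set" where
  "induced_map f K = f ` K"

lemma bdd_above_infdist_image:
  assumes "bounded A"
  shows "bdd_above ((\<lambda>a. infdist a B) ` A)"
proof (cases "A = {} \<or> B = {}")
  case True
  then show ?thesis by (auto simp: infdist_def)
next
  case False
  then obtain b where b: "b \<in> B" by blast
  obtain e where e: "\<And>a. a \<in> A \<Longrightarrow> dist b a \<le> e"
    using assms by (auto simp: bounded_any_center[of A b])
  show ?thesis
  proof (rule bdd_aboveI2)
    fix a assume "a \<in> A"
    then show "infdist a B \<le> e"
      using infdist_le[OF b, of a] e[of a] by (simp add: dist_commute)
  qed
qed

lemma infdist_le_hausdorff_dist:
  assumes "bounded A" "bounded B" "B \<noteq> {}" "a \<in> A"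
  shows "infdist a B \<le> hausdorff_dist A B"
proof -
  have "infdist a B \<le> (SUP a\<in>A. infdist a B)"
    using assms by (intro cSUP_upper bdd_above_infdist_image)
  then show ?thesis
    using assms by (auto simp: hausdorff_dist_def)
qed

lemma hausdorff_dist_commute: "hausdorff_dist A B = hausdorff_dist B A"
  by (auto simp: hausdorff_dist_def max.commute)

lemma hausdorff_dist_nonneg: "0 \<le> hausdorff_dist A B"
proof (cases "A = {} \<or> B = {} \<or> \<not> bounded A \<or> \<not> bounded B")
  case True
  then show ?thesis by (simp only: hausdorff_dist_def if_True)
next
  case False
  then obtain a where "a \<in> A" by blast
  then show ?thesis
    using False infdist_le_hausdorff_dist[of A B a] infdist_nonneg[of a B] by simp
qed

lemma hausdorff_dist_le:
  assumes "A \<noteq> {}" "B \<noteq> {}"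
    and "\<And>a. a \<in> A \<Longrightarrow> infdist a B \<le> r" "\<And>b. b \<in> B \<Longrightarrow> infdist b A \<le> r" "0 \<le> r"
  shows "hausdorff_dist A B \<le> r"
  using assms by (auto simp: hausdorff_dist_def intro!: cSUP_least)

lemma infdist_triangle_hausdorff_dist:
  assumes "bounded B" "bounded C" "B \<noteq> {}" "C \<noteq> {}"
  shows "infdist a C \<le> infdist a B + hausdorff_dist B C"
proof -
  have "infdist a C - hausdorff_dist B C \<le> dist a b" if "b \<in> B" for b
    using infdist_triangle[of a C b] infdist_le_hausdorff_dist[of B C b] assms that by linarith
  then have "infdist a C - hausdorff_dist B C \<le> infdist a B"
    unfolding infdist_notempty[OF \<open>B \<noteq> {}\<close>] by (intro cINF_greatest \<open>B \<noteq> {}\<close>)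
  then show ?thesis by simp
qed

lemma Metric_space_compact_hyperspace:
  "Metric_space (compact_hyperspace X) hausdorff_dist"
proof
  fix A B C :: "'a set"
  show "0 \<le> hausdorff_dist A B" by (rule hausdorff_dist_nonneg)
  show "hausdorff_dist A B = hausdorff_dist B A" by (rule hausdorff_dist_commute)
  show "hausdorff_dist A B = 0 \<longleftrightarrow> A = B"
    if "A \<in> compact_hyperspace X" "B \<in> compact_hyperspace X"
  proof
    have cl: "closed A" "closed B" and bd: "bounded A" "bounded B" and ne: "A \<noteq> {}" "B \<noteq> {}"
      using that by (auto simp: compact_hyperspace_def compact_imp_closed compact_imp_bounded)
    show "A = B" if "hausdorff_dist A B = 0"
    proof -
      have "a \<in> B" if "a \<in> A" for a
        using infdist_le_hausdorff_dist[of A B a] infdist_nonneg[of a B] bd ne that cl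
          \<open>hausdorff_dist A B = 0\<close> by (simp add: in_closed_iff_infdist_zero)
      moreover have "b \<in> A" if "b \<in> B" for b
        using infdist_le_hausdorff_dist[of B A b] infdist_nonneg[of b A] bd ne that cl
          \<open>hausdorff_dist A B = 0\<close> hausdorff_dist_commute[of A B]
        by (simp add: in_closed_iff_infdist_zero)
      ultimately show ?thesis by blast
    qed
    show "hausdorff_dist A B = 0" if "A = B"
    proof (rule order_antisym)
      show "hausdorff_dist A B \<le> 0"
        using ne unfolding that by (intro hausdorff_dist_le) auto
    qed (rule hausdorff_dist_nonneg)
  qed
  show "hausdorff_dist A C \<le> hausdorff_dist A B + hausdorff_dist B C"
    if "A \<in> compact_hyperspace X" "B \<in> compact_hyperspace X" "C \<in> compact_hyperspace X"
  proof -
    have bd: "bounded A" "bounded B" "bounded C" and ne: "A \<noteq> {}" "B \<noteq> {}" "C \<noteq> {}"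
      using that by (auto simp: compact_hyperspace_def compact_imp_bounded)
    show ?thesis
    proof (rule hausdorff_dist_le)
      show "infdist a C \<le> hausdorff_dist A B + hausdorff_dist B C" if "a \<in> A" for a
        using infdist_triangle_hausdorff_dist[of B C a] infdist_le_hausdorff_dist[of A B a]
          bd ne that by simp
      show "infdist c A \<le> hausdorff_dist A B + hausdorff_dist B C" if "c \<in> C" for c
        using infdist_triangle_hausdorff_dist[of B A c] infdist_le_hausdorff_dist[of C B c]
          bd ne that by (simp add: hausdorff_dist_commute)
    qed (use ne in \<open>simp_all add: hausdorff_dist_nonneg\<close>)
  qed
qed

lemma induced_map_in_compact_hyperspace:
  assumes "continuous_on X f" "f \<in> X \<rightarrow> X" "K \<in> compact_hyperspace X"
  shows "induced_map f K \<in> compact_hyperspace X"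
proof -
  have K: "K \<noteq> {}" "compact K" "K \<subseteq> X"
    using assms(3) by (auto simp: compact_hyperspace_def)
  have "compact (f ` K)"
    using compact_continuous_image[OF continuous_on_subset[OF assms(1) K(3)] K(2)] .
  then show ?thesis
    using K assms(2) by (auto simp: compact_hyperspace_def induced_map_def)
qed

end

theory Submission
  imports Defs
begin

text \<open>No property of the interval beyond compactness is used. The complement of the Li-Yorke
  pairs consists of the non-proximal and of the asymptotic pairs. The non-proximal pairs form a
  countable union of closed sets; if one of these contained a non-empty open set \<open>W\<close>, then a
  Li-Yorke pair \<open>(K, L)\<close> of the induced map with \<open>K \<times> L \<subseteq> W\<close> would contain a point pair coming
  closer than allowed. The asymptotic pairs form \<open>\<Inter>k. \<Union>N. F k N\<close>, where \<open>F k N\<close> is the closed set of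
  pairs that stay within \<open>1 / (k + 1)\<close> from time \<open>N\<close> on. If this set is not of first category, all the
  open sets \<open>G k = (\<Union>N. interior (F k N))\<close> are dense in a common non-empty open set \<open>W\<close>. Perturbing
  finite nets shows that \<open>K \<times> L \<subseteq> G k\<close> for all \<open>k\<close> holds for generic \<open>(K, L)\<close> with \<open>K \<times> L \<subseteq> W\<close>, and
  by compactness of \<open>K \<times> L\<close> every such \<open>(K, L)\<close> is asymptotic for the induced map. Since the hyperspace
  is complete, this contradicts generic chaos of the induced map.\<close>

section \<open>Baire category\<close>

lemma nowhere_dense_in_subset:
  assumes "nowhere_dense_in T B" "A \<subseteq> B"
  shows "nowhere_dense_in T A"
  using assms interior_of_mono[OF closure_of_mono[OF assms(2)], of T T]
  by (auto simp: nowhere_dense_in_def)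

lemma nowhere_dense_in_closedin:
  assumes "closedin T F"
  shows "nowhere_dense_in T F \<longleftrightarrow> T interior_of F = {}"
  using assms by (simp add: nowhere_dense_in_def closure_of_closedin closedin_subset)

text \<open>An open subset of \<open>F\<close> already lies in the interior of \<open>F\<close>, so
  nothing open survives in the difference, which is closed.\<close>

lemma nowhere_dense_in_Diff_interior_of:
  assumes "closedin T F"
  shows "nowhere_dense_in T (F - T interior_of F)"
proof -
  have "V = {}" if "openin T V" "V \<subseteq> F - T interior_of F" for V
    using that interior_of_maximal[of V F T] by blast
  then show ?thesis
    using assms by (simp add: nowhere_dense_in_closedin closedin_diff interior_of_eq_empty)
qed

text \<open>A non-empty open \<open>V\<close> inside the closure of \<open>W - D\<close> meets
  \<open>W\<close>, hence \<open>D\<close>. Then \<open>V \<inter> D\<close> is open, non-empty and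
  still inside that closure, so it would have to meet \<open>W - D\<close>. Density of
  \<open>D\<close> is asked only relative to \<open>W\<close>.\<close>

lemma nowhere_dense_in_Diff_dense_open:
  assumes "openin T W" "openin T D" "W \<subseteq> T closure_of D"
  shows "nowhere_dense_in T (W - D)"
proof -
  have "V = {}" if V: "openin T V" "V \<subseteq> T closure_of (W - D)" for V
  proof (rule ccontr)
    assume "V \<noteq> {}"
    then obtain w where w: "w \<in> W" "w \<in> V"
      using V unfolding in_closure_of subset_iff by (meson Diff_iff all_not_in_conv)
    then obtain v where v: "v \<in> D" "v \<in> V"
      using V(1) assms(3) unfolding in_closure_of subset_iff by meson
    then obtain u where "u \<in> W - D" "u \<in> V \<inter> D"
      using V assms(2) openin_Int[OF V(1) assms(2)] unfolding in_closure_of subset_iff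
      by (meson IntI)
    then show False by blast
  qed
  then show ?thesis
    using openin_subset[OF assms(1)] by (auto simp: nowhere_dense_in_def interior_of_eq_empty)
qed

text \<open>The definition asks for a sequence with union exactly \<open>S\<close>; this is the
  flexible criterion, with any countable family that covers \<open>S\<close>.\<close>

lemma first_category_in_subset_Union:
  assumes "countable \<A>" "\<And>A. A \<in> \<A> \<Longrightarrow> nowhere_dense_in T A" "S \<subseteq> \<Union>\<A>"
  shows "first_category_in T S"
proof -
  \<comment> \<open>Adding \<open>{}\<close> makes the family non-empty, as its enumeration
    requires; intersecting with \<open>S\<close> turns the cover into an equality.\<close>
  define A where "A n = from_nat_into (insert {} \<A>) n \<inter> S" for n
  have "nowhere_dense_in T (A n)" for n
  proof -
    have "nowhere_dense_in T (from_nat_into (insert {} \<A>) n)"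
      using from_nat_into[of "insert {} \<A>" n] assms(2) by (auto simp: nowhere_dense_in_def)
    then show ?thesis
      unfolding A_def by (rule nowhere_dense_in_subset) blast
  qed
  moreover have "S = (\<Union>n. A n)"
    using assms range_from_nat_into[of "insert {} \<A>"] unfolding A_def by fastforce
  ultimately show ?thesis
    unfolding first_category_in_def by blast
qed

lemma first_category_in_UN:
  assumes "countable I" "\<And>i. i \<in> I \<Longrightarrow> first_category_in T (S i)"
  shows "first_category_in T (\<Union>i\<in>I. S i)"
proof -
  have "\<forall>i\<in>I. \<exists>A :: nat \<Rightarrow> _. (\<forall>n. nowhere_dense_in T (A n)) \<and> S i = (\<Union>n. A n)"
    using assms(2) by (simp add: first_category_in_def)
  then obtain A :: "_ \<Rightarrow> nat \<Rightarrow> _"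
    where A: "\<And>i n. i \<in> I \<Longrightarrow> nowhere_dense_in T (A i n)" "\<And>i. i \<in> I \<Longrightarrow> S i = (\<Union>n. A i n)"
    by metis
  show ?thesis
    by (rule first_category_in_subset_Union[where \<A> = "\<Union>i\<in>I. range (A i)"])
      (use assms(1) A in auto)
qed

lemma first_category_in_subset:
  assumes "first_category_in T B" "A \<subseteq> B"
  shows "first_category_in T A"
proof -
  obtain F :: "nat \<Rightarrow> _" where "\<And>n. nowhere_dense_in T (F n)" "B = (\<Union>n. F n)"
    using assms(1) by (auto simp: first_category_in_def)
  then show ?thesis
    using assms(2) by (intro first_category_in_subset_Union[of "range F"]) auto
qed

lemma first_category_in_Un:
  assumes "first_category_in T A" "first_category_in T B"
  shows "first_category_in T (A \<union> B)"
proof -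
  have "first_category_in T (\<Union>S\<in>{A, B}. S)"
    using assms by (intro first_category_in_UN) auto
  then show ?thesis by simp
qed

lemma nowhere_dense_imp_first_category:
  "nowhere_dense_in T S \<Longrightarrow> first_category_in T S"
  by (rule first_category_in_subset_Union[of "{S}"]) auto

text \<open>The Baire category theorem, applied to the closures of the nowhere dense pieces, which
  are closed with empty interior.\<close>

lemma openin_not_first_category:
  assumes "completely_metrizable_space T" "openin T W" "W \<noteq> {}"
  shows "\<not> first_category_in T W"
proof
  assume "first_category_in T W"
  then obtain A :: "nat \<Rightarrow> _" where A: "\<And>n. nowhere_dense_in T (A n)" "W = (\<Union>n. A n)"
    by (auto simp: first_category_in_def)
  have "T interior_of \<Union>(range (\<lambda>n. T closure_of (A n))) = {}"
    using assms(1) A by (intro Baire_category_alt) (auto simp: nowhere_dense_in_def)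
  moreover have "W \<subseteq> \<Union>(range (\<lambda>n. T closure_of (A n)))"
    using A closure_of_subset unfolding nowhere_dense_in_def by fastforce
  ultimately show False
    using assms(2,3) unfolding interior_of_eq_empty by blast
qed

lemma residual_in_meets_openin:
  assumes "completely_metrizable_space T" "residual_in T S" "openin T W" "W \<noteq> {}"
  shows "S \<inter> W \<noteq> {}"
proof
  assume "S \<inter> W = {}"
  then have "W \<subseteq> topspace T - S"
    using openin_subset[OF assms(3)] by blast
  then show False
    using assms openin_not_first_category first_category_in_subset unfolding residual_in_def
    by blast
qed

text \<open>Each \<open>F k N\<close> exceeds its interior by a nowhere dense set. Off the countable
  union of these excesses, a point of the left-hand set lies in some interior for every
  \<open>k\<close>, hence in the closed set \<open>?C\<close>, which has empty interior. Used
  contrapositively, it yields one open set in which all the unions of interiors are dense.\<close>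

lemma first_category_in_INT_UN_closedin:
  fixes F :: "nat \<Rightarrow> nat \<Rightarrow> 'a set"
  assumes "\<And>k N. closedin T (F k N)"
    and "T interior_of (\<Inter>k. T closure_of (\<Union>N. T interior_of F k N)) = {}"
  shows "first_category_in T (\<Inter>k. \<Union>N. F k N)"
proof -
  let ?C = "\<Inter>k. T closure_of (\<Union>N. T interior_of F k N)"
  have "closedin T ?C"
    by (intro closedin_Inter) auto
  then have "first_category_in T ?C"
    using assms(2) by (intro nowhere_dense_imp_first_category) (simp add: nowhere_dense_in_closedin)
  moreover have "first_category_in T (\<Union>k. \<Union>N. F k N - T interior_of F k N)"
    using assms(1)
    by (intro first_category_in_UN nowhere_dense_imp_first_category
        nowhere_dense_in_Diff_interior_of) auto
  moreover have "(\<Inter>k. \<Union>N. F k N) \<subseteq> ?C \<union> (\<Union>k. \<Union>N. F k N - T interior_of F k N)"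
  proof
    fix x assume x: "x \<in> (\<Inter>k. \<Union>N. F k N)"
    have "x \<in> T closure_of (\<Union>N. T interior_of F k N)"
      if "x \<notin> (\<Union>k. \<Union>N. F k N - T interior_of F k N)" for k
    proof -
      obtain N where "x \<in> F k N"
        using x by auto
      with that have "x \<in> T interior_of F k N"
        by simp
      moreover have "(\<Union>N. T interior_of F k N) \<subseteq> T closure_of (\<Union>N. T interior_of F k N)"
        by (intro closure_of_subset UN_least interior_of_subset_topspace)
      ultimately show ?thesis
        by (meson UN_I UNIV_I subsetD)
    qed
    then show "x \<in> ?C \<union> (\<Union>k. \<Union>N. F k N - T interior_of F k N)"
      by blast
  qed
  ultimately show ?thesis
    by (rule first_category_in_subset[OF first_category_in_Un])
qed


section \<open>Metric topologies\<close>

text \<open>Identifies the topology in \<open>generically_chaotic\<close> for the base map with the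
  usual subspace topology.\<close>

lemma mtopology_dist: "Metric_space.mtopology X dist = top_of_set X"
proof -
  interpret Submetric UNIV dist X
    by unfold_locales auto
  show ?thesis
    using mtopology_submetric by simp
qed

text \<open>Products of balls form a base, and the smaller of two radii serves both factors. Keeping
  the factors apart avoids choosing a metric on the product.\<close>

lemma (in Metric_space) openin_prod_mtopology:
  "openin (prod_topology mtopology mtopology) S \<longleftrightarrow>
     S \<subseteq> M \<times> M \<and>
     (\<forall>x y. (x, y) \<in> S \<longrightarrow>
        (\<exists>e>0. \<forall>x'\<in>M. \<forall>y'\<in>M. d x x' < e \<longrightarrow> d y y' < e \<longrightarrow> (x', y') \<in> S))"
  (is "?L \<longleftrightarrow> ?R")
proof
  assume L: ?L
  have "\<exists>e>0. \<forall>x'\<in>M. \<forall>y'\<in>M. d x x' < e \<longrightarrow> d y y' < e \<longrightarrow> (x', y') \<in> S"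
    if xy: "(x, y) \<in> S" for x y
  proof -
    obtain U V where U: "openin mtopology U" "x \<in> U" and V: "openin mtopology V" "y \<in> V"
      and UV: "U \<times> V \<subseteq> S"
      using L xy unfolding openin_prod_topology_alt by blast
    obtain a b where a: "a > 0" "mball x a \<subseteq> U" and b: "b > 0" "mball y b \<subseteq> V"
      using U V unfolding openin_mtopology by blast
    have M: "x \<in> M" "y \<in> M"
      using U V openin_mtopology by auto
    show ?thesis
      by (rule exI[of _ "min a b"]) (use a b M UV in \<open>auto simp: subset_iff\<close>)
  qed
  then show ?R
    using openin_subset[OF L] by auto
next
  assume R: ?R
  show ?L
    unfolding openin_prod_topology_alt
  proof (intro allI impI)
    fix x y assume xy: "(x, y) \<in> S"
    then obtain e where e: "e > 0"
      "\<And>x' y'. x' \<in> M \<Longrightarrow> y' \<in> M \<Longrightarrow> d x x' < e \<Longrightarrow> d y y' < e \<Longrightarrow> (x', y') \<in> S"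
      using R by blast
    have "x \<in> M" "y \<in> M"
      using R xy by auto
    then show "\<exists>U V. openin mtopology U \<and> openin mtopology V \<and> x \<in> U \<and> y \<in> V \<and> U \<times> V \<subseteq> S"
      using e by (intro exI[of _ "mball x e"] exI[of _ "mball y e"]) auto
  qed
qed

text \<open>A compact set inside an open set has a uniform neighbourhood inside it. Half of that
  radius suffices in each factor, since the product distance is at most the sum of the two
  distances.\<close>

lemma compact_Times_openin_thickening:
  fixes X K L :: "'a::metric_space set"
  assumes "compact K" "compact L" "K \<times> L \<subseteq> W" "openin (top_of_set (X \<times> X)) W"
  obtains e where "e > 0"
    "\<And>x y x' y'. x \<in> K \<Longrightarrow> y \<in> L \<Longrightarrow> x' \<in> X \<Longrightarrow> y' \<in> X \<Longrightarrow> dist x x' < e \<Longrightarrow> dist y y' < e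
       \<Longrightarrow> (x', y') \<in> W"
proof -
  obtain U where U: "open U" "W = X \<times> X \<inter> U"
    using assms(4) unfolding openin_open by blast
  obtain r where r: "r > 0" "(\<Union>z\<in>K \<times> L. ball z r) \<subseteq> U"
    using compact_subset_open_imp_ball_epsilon_subset[of "K \<times> L" U] assms U compact_Times by blast
  show ?thesis
  proof
    show "r / 2 > 0" using r by simp
    fix x y x' y' assume *: "x \<in> K" "y \<in> L" "x' \<in> X" "y' \<in> X" "dist x x' < r / 2" "dist y y' < r / 2"
    have "dist (x, y) (x', y') \<le> dist x x' + dist y y'"
      unfolding dist_Pair_Pair by (rule sqrt_sum_squares_le_sum) auto
    then have "(x', y') \<in> ball (x, y) r"
      using * by simp
    then show "(x', y') \<in> W"
      using * r(2) U(2) by blast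
  qed
qed


section \<open>The hyperspace\<close>

lemma compact_hyperspaceD:
  assumes "K \<in> compact_hyperspace X"
  shows "K \<noteq> {}" "compact K" "K \<subseteq> X" "bounded K"
  using assms by (auto simp: compact_hyperspace_def compact_imp_bounded)

lemma infdist_less_iff:
  assumes "B \<noteq> {}"
  shows "infdist a B < e \<longleftrightarrow> (\<exists>b\<in>B. dist a b < e)"
  using assms by (simp add: infdist_notempty cINF_less_iff)

text \<open>Strictness turns the infimum in \<open>infdist\<close> into an actual nearby
  point.\<close>

lemma hausdorff_dist_lessE:
  assumes "A \<in> compact_hyperspace X" "B \<in> compact_hyperspace Y" "hausdorff_dist A B < e" "a \<in> A"
  obtains b where "b \<in> B" "dist a b < e"
  using infdist_le_hausdorff_dist[of A B a] assms compact_hyperspaceD(1,4) infdist_less_iff[of B a e]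
  by (metis le_less_trans)

text \<open>The limit of a Cauchy sequence is the set \<open>K\<close> of points belonging to the
  closure of every tail union. Completeness is what makes the Baire category theorem available in
  the hyperspace.\<close>

lemma mcomplete_compact_hyperspace:
  fixes X :: "'a::metric_space set"
  assumes "compact X"
  shows "Metric_space.mcomplete (compact_hyperspace X) hausdorff_dist"
proof -
  interpret Metric_space "compact_hyperspace X" hausdorff_dist
    by (rule Metric_space_compact_hyperspace)
  show ?thesis
    unfolding mcomplete_def
  proof (intro allI impI)
    fix \<sigma> assume \<sigma>: "MCauchy \<sigma>"
    then have H: "\<sigma> n \<in> compact_hyperspace X" for n
      by (auto simp: MCauchy_def)
    have Cauchy: "\<exists>N. \<forall>n\<ge>N. \<forall>m\<ge>N. hausdorff_dist (\<sigma> n) (\<sigma> m) < e" if "e > 0" for e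
      using \<sigma> that unfolding MCauchy_def by meson
    define T where "T m = closure (\<Union>j\<in>{m..}. \<sigma> j)" for m
    define K where "K = (\<Inter>m. T m)"
    have "T m \<subseteq> X" for m
      unfolding T_def using compact_hyperspaceD(3)[OF H]
      by (intro closure_minimal compact_imp_closed[OF assms] UN_least)
    then have "K \<subseteq> X"
      unfolding K_def by blast
    \<comment> \<open>The compact sets \<open>T m \<inter> cball a e\<close> are non-empty and decreasing.\<close>
    have near_K: "\<exists>y\<in>K. dist a y \<le> e"
      if N: "\<And>n m. n \<ge> N \<Longrightarrow> m \<ge> N \<Longrightarrow> hausdorff_dist (\<sigma> n) (\<sigma> m) < e"
        and n: "n \<ge> N" "a \<in> \<sigma> n" for N n e a
    proof -
      have "X \<inter> (\<Inter>m\<in>UNIV. T m \<inter> cball a e) \<noteq> {}"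
      proof (rule compact_imp_fip_image[OF assms])
        show "closed (T m \<inter> cball a e)" for m
          by (auto simp: T_def)
        fix I :: "nat set" assume "finite I"
        \<comment> \<open>With an index beyond \<open>N\<close> and all of \<open>I\<close>, a point
          of \<open>\<sigma> m\<close> lies in every \<open>T i\<close> with
          \<open>i \<in> I\<close>, and the Cauchy estimate puts one near \<open>a\<close>.\<close>
        define m where "m = Max (insert N I)"
        have m: "m \<ge> N" "\<And>i. i \<in> I \<Longrightarrow> i \<le> m"
          using \<open>finite I\<close> by (auto simp: m_def)
        obtain z where z: "z \<in> \<sigma> m" "dist a z < e"
          using hausdorff_dist_lessE[OF H H N[OF n(1) m(1)] n(2)] .
        have "z \<in> T i" if "i \<in> I" for i
          using z(1) m(2)[OF that] closure_subset unfolding T_def by fastforce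
        then show "X \<inter> (\<Inter>i\<in>I. T i \<inter> cball a e) \<noteq> {}"
          using z H[of m] compact_hyperspaceD(3) by fastforce
      qed
      then show ?thesis
        unfolding K_def by auto
    qed
    \<comment> \<open>The radius 1 is arbitrary: any instance of \<open>near_K\<close> shows that
      \<open>K\<close> is non-empty.\<close>
    obtain N1 where N1: "\<And>n m. n \<ge> N1 \<Longrightarrow> m \<ge> N1 \<Longrightarrow> hausdorff_dist (\<sigma> n) (\<sigma> m) < 1"
      using Cauchy[of 1] by auto
    obtain a where "a \<in> \<sigma> N1"
      using compact_hyperspaceD(1)[OF H] by blast
    then have "K \<noteq> {}"
      using near_K[OF N1 order_refl] by blast
    moreover have "closed K"
      unfolding K_def T_def by auto
    ultimately have K: "K \<in> compact_hyperspace X"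
      using \<open>K \<subseteq> X\<close> assms compact_Int_closed[OF assms, of K]
      by (simp add: compact_hyperspace_def Int_absorb1)
    have "\<exists>N. \<forall>n\<ge>N. \<sigma> n \<in> compact_hyperspace X \<and> hausdorff_dist (\<sigma> n) K < e" if e: "e > 0" for e
    proof -
      obtain N where N: "\<And>n m. n \<ge> N \<Longrightarrow> m \<ge> N \<Longrightarrow> hausdorff_dist (\<sigma> n) (\<sigma> m) < e / 4"
        using Cauchy[of "e / 4"] e by auto
      \<comment> \<open>Two errors of \<open>e / 4\<close> can add up below, and
        \<open>hausdorff_dist_le\<close> gives only a weak inequality, so \<open>e / 2\<close>
        leaves room for the strict bound by \<open>e\<close>.\<close>
      have "hausdorff_dist (\<sigma> n) K \<le> e / 2" if n: "n \<ge> N" for n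
      proof (rule hausdorff_dist_le)
        show "infdist a K \<le> e / 2" if "a \<in> \<sigma> n" for a
          using near_K[OF N n that] infdist_le[of _ K a] e by fastforce
        show "infdist y (\<sigma> n) \<le> e / 2" if "y \<in> K" for y
        proof -
          \<comment> \<open>A point of \<open>K\<close> is approximated by a point of some later
            \<open>\<sigma> m\<close>, which the Cauchy estimate moves into
            \<open>\<sigma> n\<close>.\<close>
          have "y \<in> T n"
            using that by (simp add: K_def)
          then obtain m z where z: "m \<ge> n" "z \<in> \<sigma> m" "dist z y < e / 4"
            unfolding T_def closure_approachable using e
            by (metis UN_E atLeast_iff divide_pos_pos zero_less_numeral)
          obtain w where w: "w \<in> \<sigma> n" "dist z w < e / 4"
            using hausdorff_dist_lessE[OF H H N[OF order_trans[OF n z(1)] n] z(2)] .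
          have "dist y w \<le> e / 2"
            using dist_triangle[of y w z] w z(3) by (simp add: dist_commute)
          then show ?thesis
            using w(1) by (rule infdist_le2[rotated])
        qed
      qed (use K H compact_hyperspaceD e in auto)
      then have "hausdorff_dist (\<sigma> n) K < e" if "n \<ge> N" for n
        using e that by fastforce
      then show ?thesis
        using H by blast
    qed
    then have "limitin mtopology \<sigma> K sequentially"
      using K by (simp add: limitin_metric eventually_sequentially)
    then show "\<exists>K. limitin mtopology \<sigma> K sequentially" ..
  qed
qed

section \<open>The square of the hyperspace and its open boxes\<close>

abbreviation hyperspace_prod :: "'a::metric_space set \<Rightarrow> ('a set \<times> 'a set) topology" where
  "hyperspace_prod X \<equiv>
     prod_topology (Metric_space.mtopology (compact_hyperspace X) hausdorff_dist)
       (Metric_space.mtopology (compact_hyperspace X) hausdorff_dist)"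

lemma topspace_hyperspace_prod:
  "topspace (hyperspace_prod X) = compact_hyperspace X \<times> compact_hyperspace X"
  by (simp add: Metric_space.topspace_mtopology[OF Metric_space_compact_hyperspace])

lemma completely_metrizable_hyperspace_prod:
  assumes "compact X"
  shows "completely_metrizable_space (hyperspace_prod X)"
  using Metric_space.completely_metrizable_space_mtopology[OF Metric_space_compact_hyperspace
      mcomplete_compact_hyperspace[OF assms]]
  by (simp add: completely_metrizable_space_prod_topology)

text \<open>Carries subsets of \<open>X \<times> X\<close> to the squared hyperspace; openness,
  non-emptiness and relative density of open sets all pass to the boxes.\<close>

definition hyperspace_box :: "'a::metric_space set \<Rightarrow> ('a \<times> 'a) set \<Rightarrow> ('a set \<times> 'a set) set" where
  "hyperspace_box X W = {(K, L) \<in> compact_hyperspace X \<times> compact_hyperspace X. K \<times> L \<subseteq> W}"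

text \<open>Compactness gives one thickening radius for all of \<open>K \<times> L\<close>, and
  every point of a Hausdorff-close pair of sets lies within that radius of a point of
  \<open>K\<close> or \<open>L\<close>.\<close>

lemma openin_hyperspace_box:
  assumes "openin (top_of_set (X \<times> X)) W"
  shows "openin (hyperspace_prod X) (hyperspace_box X W)"
  unfolding Metric_space.openin_prod_mtopology[OF Metric_space_compact_hyperspace]
proof (intro conjI allI impI)
  fix K L assume KL: "(K, L) \<in> hyperspace_box X W"
  then have K: "K \<in> compact_hyperspace X" and L: "L \<in> compact_hyperspace X" and W: "K \<times> L \<subseteq> W"
    by (auto simp: hyperspace_box_def)
  obtain e where "e > 0" and e:
    "\<And>x y x' y'. x \<in> K \<Longrightarrow> y \<in> L \<Longrightarrow> x' \<in> X \<Longrightarrow> y' \<in> X \<Longrightarrow> dist x x' < e \<Longrightarrow> dist y y' < e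
       \<Longrightarrow> (x', y') \<in> W"
    using compact_Times_openin_thickening[OF _ _ W assms] compact_hyperspaceD(2) K L by metis
  have "(K', L') \<in> hyperspace_box X W"
    if K': "K' \<in> compact_hyperspace X" "hausdorff_dist K K' < e"
      and L': "L' \<in> compact_hyperspace X" "hausdorff_dist L L' < e" for K' L'
  proof -
    have "(x', y') \<in> W" if x': "x' \<in> K'" and y': "y' \<in> L'" for x' y'
    proof -
      obtain x where "x \<in> K" "dist x' x < e"
        using hausdorff_dist_lessE[OF K'(1) K _ x'] K'(2) by (metis hausdorff_dist_commute)
      moreover obtain y where "y \<in> L" "dist y' y < e"
        using hausdorff_dist_lessE[OF L'(1) L _ y'] L'(2) by (metis hausdorff_dist_commute)
      ultimately show ?thesis
        using e[of x y x' y'] x' y' compact_hyperspaceD(3) K'(1) L'(1)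
        by (metis dist_commute subsetD)
    qed
    then show ?thesis
      using K'(1) L'(1) by (auto simp: hyperspace_box_def)
  qed
  then show "\<exists>e>0. \<forall>K'\<in>compact_hyperspace X. \<forall>L'\<in>compact_hyperspace X.
      hausdorff_dist K K' < e \<longrightarrow> hausdorff_dist L L' < e \<longrightarrow> (K', L') \<in> hyperspace_box X W"
    using \<open>e > 0\<close> by blast
qed (auto simp: hyperspace_box_def)

lemma hyperspace_box_nonempty:
  assumes "openin (top_of_set (X \<times> X)) W" "W \<noteq> {}"
  shows "hyperspace_box X W \<noteq> {}"
proof -
  obtain x y where "(x, y) \<in> W"
    using assms(2) by auto
  moreover then have "x \<in> X" "y \<in> X"
    using openin_imp_subset[OF assms(1)] by auto
  ultimately have "({x}, {y}) \<in> hyperspace_box X W"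
    by (auto simp: hyperspace_box_def compact_hyperspace_def)
  then show ?thesis by blast
qed

section \<open>Transfer of relative density to the hyperspace\<close>

lemma shrink_boxes_into_dense_open:
  fixes W G :: "('a::topological_space \<times> 'b::topological_space) set"
  assumes "finite Q" "Q \<subseteq> I \<times> J"
    and "openin (top_of_set (X \<times> Y)) G" "W \<subseteq> top_of_set (X \<times> Y) closure_of G"
    and "\<And>i. i \<in> I \<Longrightarrow> openin (top_of_set X) (A i) \<and> A i \<noteq> {}"
    and "\<And>j. j \<in> J \<Longrightarrow> openin (top_of_set Y) (B j) \<and> B j \<noteq> {}"
    and "\<And>i j. i \<in> I \<Longrightarrow> j \<in> J \<Longrightarrow> A i \<times> B j \<subseteq> W"
  shows "\<exists>A' B'. (\<forall>i\<in>I. openin (top_of_set X) (A' i) \<and> A' i \<noteq> {} \<and> A' i \<subseteq> A i) \<and>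
                 (\<forall>j\<in>J. openin (top_of_set Y) (B' j) \<and> B' j \<noteq> {} \<and> B' j \<subseteq> B j) \<and>
                 (\<forall>(i, j)\<in>Q. A' i \<times> B' j \<subseteq> G)"
  using assms(1,2)
  \<comment> \<open>Working with open sets instead of points, later shrinkings preserve the inclusions already
    achieved.\<close>
proof (induction Q)
  case empty
  show ?case
    using assms(5,6) by (intro exI[of _ A] exI[of _ B]) auto
next
  case (insert q Q)
  obtain i j where q: "q = (i, j)" "i \<in> I" "j \<in> J"
    using insert.prems by auto
  obtain A' B' where
    A': "\<forall>i\<in>I. openin (top_of_set X) (A' i) \<and> A' i \<noteq> {} \<and> A' i \<subseteq> A i" and
    B': "\<forall>j\<in>J. openin (top_of_set Y) (B' j) \<and> B' j \<noteq> {} \<and> B' j \<subseteq> B j" and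
    G: "\<forall>(i, j)\<in>Q. A' i \<times> B' j \<subseteq> G"
    using insert.IH insert.prems by auto
  have box: "openin (top_of_set (X \<times> Y)) (A' i \<times> B' j)"
    using A' B' q by (intro openin_Times) auto
  have "A' i \<times> B' j \<subseteq> W" "A' i \<times> B' j \<noteq> {}"
    using A' B' q assms(7)[OF q(2,3)] by blast+
  \<comment> \<open>Density of \<open>G\<close> in \<open>W\<close> gives a point of
    \<open>G\<close> in the current box, and openness of \<open>G\<close> then gives a whole smaller
    box \<open>U \<times> V\<close> around it.\<close>
  then obtain x y where "(x, y) \<in> A' i \<times> B' j" "(x, y) \<in> G"
    using box assms(4) unfolding subset_iff in_closure_of by (metis equals0I prod.exhaust)
  moreover have "openin (prod_topology (top_of_set X) (top_of_set Y)) (A' i \<times> B' j \<inter> G)"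
    using openin_Int[OF box assms(3)] by simp
  ultimately obtain U V where
    U: "openin (top_of_set X) U" "x \<in> U" and V: "openin (top_of_set Y) V" "y \<in> V"
    and UV: "U \<times> V \<subseteq> A' i \<times> B' j \<inter> G"
    unfolding openin_prod_topology_alt by (metis IntI)
  then have sub: "U \<subseteq> A' i" "V \<subseteq> B' j" "U \<times> V \<subseteq> G"
    by auto
  show ?case
  proof (intro exI[of _ "A'(i := U)"] exI[of _ "B'(j := V)"] conjI)
    have "(A'(i := U)) i' \<times> (B'(j := V)) j' \<subseteq> G" if "(i', j') \<in> insert q Q" for i' j'
    proof (cases "(i', j') = q")
      case True
      then show ?thesis using sub q(1) by simp
    next
      case False
      then have "A' i' \<times> B' j' \<subseteq> G" using that G by blast
      moreover have "(A'(i := U)) i' \<subseteq> A' i'" "(B'(j := V)) j' \<subseteq> B' j'"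
        using sub by auto
      ultimately show ?thesis by blast
    qed
    then show "\<forall>(i', j')\<in>insert q Q. (A'(i := U)) i' \<times> (B'(j := V)) j' \<subseteq> G"
      by blast
    have "U \<subseteq> A i" "V \<subseteq> B j"
      using A' B' sub q by blast+
    then show "\<forall>i'\<in>I. openin (top_of_set X) ((A'(i := U)) i') \<and> (A'(i := U)) i' \<noteq> {} \<and>
                 (A'(i := U)) i' \<subseteq> A i'"
      and "\<forall>j'\<in>J. openin (top_of_set Y) ((B'(j := V)) j') \<and> (B'(j := V)) j' \<noteq> {} \<and>
                 (B'(j := V)) j' \<subseteq> B j'"
      using A' B' U V by auto
  qed
qed


text \<open>A point of \<open>K\<close> is within \<open>r\<close> of the net, and each net point
  moves by less than \<open>r\<close>. Conversely, every moved point stays within \<open>r\<close>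
  of its original, which lies in \<open>K\<close>.\<close>

lemma hausdorff_dist_perturbed_net:
  assumes "K \<in> compact_hyperspace X" "finite S" "S \<subseteq> K" "K \<subseteq> (\<Union>x\<in>S. ball x r)"
    and "\<And>x. x \<in> S \<Longrightarrow> p x \<in> X \<inter> ball x r"
  shows "p ` S \<in> compact_hyperspace X" "hausdorff_dist K (p ` S) \<le> 2 * r"
proof -
  have K: "K \<noteq> {}"
    using compact_hyperspaceD[OF assms(1)] by auto
  then obtain x where x: "x \<in> S"
    using assms(4) by blast
  show "p ` S \<in> compact_hyperspace X"
    using assms(2,5) x by (auto simp: compact_hyperspace_def intro: finite_imp_compact)
  \<comment> \<open>Positivity is not assumed; it follows because some ball of radius
    \<open>r\<close> contains a point.\<close>
  have "0 < r"
    using assms(5)[OF x] by (metis IntD2 ball_eq_empty empty_iff not_less)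
  show "hausdorff_dist K (p ` S) \<le> 2 * r"
  proof (rule hausdorff_dist_le)
    fix a assume "a \<in> K"
    then obtain y where y: "y \<in> S" "dist y a < r"
      using assms(4) by auto
    have "dist a (p y) \<le> 2 * r"
      using dist_triangle[of a "p y" y] y assms(5)[OF y(1)] by (simp add: dist_commute)
    then show "infdist a (p ` S) \<le> 2 * r"
      using y(1) by (blast intro: infdist_le2)
  next
    fix b assume "b \<in> p ` S"
    then obtain y where y: "y \<in> S" "b = p y"
      by blast
    have "dist b y \<le> 2 * r"
      using assms(5)[OF y(1)] y(2) \<open>0 < r\<close> by (simp add: dist_commute)
    then show "infdist b K \<le> 2 * r"
      using y(1) assms(3) by (blast intro: infdist_le2)
  qed (use K x \<open>0 < r\<close> in auto)
qed

text \<open>Finite sets approximate \<open>K\<close> and \<open>L\<close>. Shrinking the balls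
  around two finite nets until all products lie in \<open>G\<close>, then picking one point in each
  shrunken set, gives finite sets near \<open>K\<close> and \<open>L\<close> whose product lies in
  \<open>G\<close>.\<close>

lemma hyperspace_box_subset_closure_of:
  assumes "openin (top_of_set (X \<times> X)) W" "openin (top_of_set (X \<times> X)) G"
    and "W \<subseteq> top_of_set (X \<times> X) closure_of G"
  shows "hyperspace_box X W \<subseteq> hyperspace_prod X closure_of hyperspace_box X G"
proof -
  have "\<exists>P. P \<in> hyperspace_box X G \<and> P \<in> V"
    if KL: "(K, L) \<in> hyperspace_box X W" "(K, L) \<in> V" and V: "openin (hyperspace_prod X) V"
    for K L V
  proof -
    have K: "K \<in> compact_hyperspace X" and L: "L \<in> compact_hyperspace X" and W: "K \<times> L \<subseteq> W"
      using KL(1) by (auto simp: hyperspace_box_def)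
    obtain e where "e > 0" and e:
      "\<And>K' L'. K' \<in> compact_hyperspace X \<Longrightarrow> L' \<in> compact_hyperspace X \<Longrightarrow>
         hausdorff_dist K K' < e \<Longrightarrow> hausdorff_dist L L' < e \<Longrightarrow> (K', L') \<in> V"
      using V KL(2)
      unfolding Metric_space.openin_prod_mtopology[OF Metric_space_compact_hyperspace] by metis
    obtain c where "c > 0" and c:
      "\<And>x y x' y'. x \<in> K \<Longrightarrow> y \<in> L \<Longrightarrow> x' \<in> X \<Longrightarrow> y' \<in> X \<Longrightarrow> dist x x' < c \<Longrightarrow> dist y y' < c
         \<Longrightarrow> (x', y') \<in> W"
      using compact_Times_openin_thickening[OF _ _ W assms(1)] compact_hyperspaceD(2) K L by metis
    \<comment> \<open>The bound \<open>2 * r < e\<close> keeps the perturbed pair in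
      \<open>V\<close>, and \<open>r \<le> c\<close> keeps the products of balls in
      \<open>W\<close>.\<close>
    define r where "r = min (e / 3) c"
    have r: "r > 0" "r \<le> c" "2 * r < e"
      using \<open>e > 0\<close> \<open>c > 0\<close> by (auto simp: r_def)
    have net: "\<exists>S\<subseteq>C. finite S \<and> C \<subseteq> (\<Union>x\<in>S. ball x r)" if "C \<in> compact_hyperspace X" for C
      using seq_compact_imp_totally_bounded[OF compact_imp_seq_compact[OF compact_hyperspaceD(2)[OF that]]]
        r(1) by blast
    obtain S where S: "finite S" "S \<subseteq> K" "K \<subseteq> (\<Union>x\<in>S. ball x r)"
      using net[OF K] by blast
    obtain R where R: "finite R" "R \<subseteq> L" "L \<subseteq> (\<Union>y\<in>R. ball y r)"
      using net[OF L] by blast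
    have ball: "openin (top_of_set X) (X \<inter> ball x r)" "X \<inter> ball x r \<noteq> {}"
      if "x \<in> C" "C \<in> compact_hyperspace X" for x C
      using that r(1) compact_hyperspaceD(3)[OF that(2)] centre_in_ball[of x r]
      by (blast intro: openin_open_Int open_ball)+
    have sub: "(X \<inter> ball x r) \<times> (X \<inter> ball y r) \<subseteq> W" if "x \<in> K" "y \<in> L" for x y
      using c[OF that] r(2) by auto
    have "\<exists>A' B'. (\<forall>x\<in>S. openin (top_of_set X) (A' x) \<and> A' x \<noteq> {} \<and> A' x \<subseteq> X \<inter> ball x r) \<and>
            (\<forall>y\<in>R. openin (top_of_set X) (B' y) \<and> B' y \<noteq> {} \<and> B' y \<subseteq> X \<inter> ball y r) \<and>
            (\<forall>(x, y)\<in>S \<times> R. A' x \<times> B' y \<subseteq> G)"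
    proof (rule shrink_boxes_into_dense_open[OF _ order_refl assms(2,3)])
      show "finite (S \<times> R)"
        using S(1) R(1) by simp
      show "openin (top_of_set X) (X \<inter> ball x r) \<and> X \<inter> ball x r \<noteq> {}" if "x \<in> S" for x
        using ball[OF _ K] S(2) that by (meson subsetD)
      show "openin (top_of_set X) (X \<inter> ball y r) \<and> X \<inter> ball y r \<noteq> {}" if "y \<in> R" for y
        using ball[OF _ L] R(2) that by (meson subsetD)
      show "(X \<inter> ball x r) \<times> (X \<inter> ball y r) \<subseteq> W" if "x \<in> S" "y \<in> R" for x y
        using sub S(2) R(2) that by (meson subsetD)
    qed
    then obtain A' B' where
      A': "\<forall>x\<in>S. openin (top_of_set X) (A' x) \<and> A' x \<noteq> {} \<and> A' x \<subseteq> X \<inter> ball x r" and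
      B': "\<forall>y\<in>R. openin (top_of_set X) (B' y) \<and> B' y \<noteq> {} \<and> B' y \<subseteq> X \<inter> ball y r" and
      G: "\<forall>(x, y)\<in>S \<times> R. A' x \<times> B' y \<subseteq> G"
      by (elim exE conjE)
    have "\<forall>x\<in>S. \<exists>a. a \<in> A' x" "\<forall>y\<in>R. \<exists>b. b \<in> B' y"
      using A' B' by auto
    then obtain p q where p: "\<And>x. x \<in> S \<Longrightarrow> p x \<in> A' x" and q: "\<And>y. y \<in> R \<Longrightarrow> q y \<in> B' y"
      by metis
    have p': "p x \<in> X \<inter> ball x r" if "x \<in> S" for x
      using A' p[OF that] that by blast
    have q': "q y \<in> X \<inter> ball y r" if "y \<in> R" for y
      using B' q[OF that] that by blast
    note pS = hausdorff_dist_perturbed_net[OF K S p'] and qR = hausdorff_dist_perturbed_net[OF L R q']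
    have "p ` S \<times> q ` R \<subseteq> G"
      using G p q by blast
    then have "(p ` S, q ` R) \<in> hyperspace_box X G"
      using pS(1) qR(1) by (simp add: hyperspace_box_def)
    moreover have "(p ` S, q ` R) \<in> V"
      using e[OF pS(1) qR(1)] pS(2) qR(2) r(3) by linarith
    ultimately show ?thesis by blast
  qed
  moreover have "hyperspace_box X W \<subseteq> topspace (hyperspace_prod X)"
    unfolding topspace_hyperspace_prod hyperspace_box_def by blast
  ultimately show ?thesis
    unfolding subset_iff in_closure_of by (metis surj_pair)
qed


section \<open>Li-Yorke pairs\<close>

text \<open>Reciprocals of positive integers as thresholds leave countably many conditions, as
  category arguments need. The strict inequality negates to a closed condition on pairs of
  points.\<close>

lemma liminf_nonneg_eq_0_iff:
  fixes u :: "nat \<Rightarrow> real"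
  assumes "\<And>n. 0 \<le> u n"
  shows "liminf (\<lambda>n. ereal (u n)) = 0 \<longleftrightarrow> (\<forall>k N. \<exists>n\<ge>N. u n < inverse (real (Suc k)))"
proof -
  have ge: "0 \<le> liminf (\<lambda>n. ereal (u n))"
    using assms by (intro Liminf_bounded) auto
  have "\<exists>n\<ge>N. u n < inverse (real (Suc k))" if "liminf (\<lambda>n. ereal (u n)) = 0" for k N
  proof (rule ccontr)
    assume "\<not> ?thesis"
    then have "ereal (inverse (real (Suc k))) \<le> liminf (\<lambda>n. ereal (u n))"
      by (intro Liminf_bounded) (auto simp: eventually_sequentially not_less intro!: exI[of _ N])
    then show False
      using that by simp
  qed
  moreover have "liminf (\<lambda>n. ereal (u n)) = 0"
    if *: "\<forall>k N. \<exists>n\<ge>N. u n < inverse (real (Suc k))"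
  proof (rule ccontr)
    assume "liminf (\<lambda>n. ereal (u n)) \<noteq> 0"
    then have "0 < liminf (\<lambda>n. ereal (u n))"
      using ge by simp
    then obtain c where c: "0 < ereal c" "ereal c < liminf (\<lambda>n. ereal (u n))"
      using ereal_dense2 by blast
    obtain k where k: "inverse (real (Suc k)) < c"
      using reals_Archimedean[of c] c(1) by auto
    obtain N where "\<And>n. n \<ge> N \<Longrightarrow> c < u n"
      using less_LiminfD[OF c(2)] by (auto simp: eventually_sequentially)
    then show False
      using *[rule_format, of N k] k by force
  qed
  ultimately show ?thesis by blast
qed

text \<open>A level strictly between 0 and the limit superior leaves room for a reciprocal below it.
  Again the strict inequality negates to a closed condition.\<close>

lemma limsup_pos_iff:
  fixes u :: "nat \<Rightarrow> real"
  shows "0 < limsup (\<lambda>n. ereal (u n)) \<longleftrightarrow> (\<exists>k. \<forall>N. \<exists>n\<ge>N. inverse (real (Suc k)) < u n)"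
proof
  assume "0 < limsup (\<lambda>n. ereal (u n))"
  then obtain c where c: "0 < ereal c" "ereal c < limsup (\<lambda>n. ereal (u n))"
    using ereal_dense2 by blast
  obtain k where k: "inverse (real (Suc k)) < c"
    using reals_Archimedean[of c] c(1) by auto
  have "\<exists>n\<ge>N. inverse (real (Suc k)) < u n" for N
  proof (rule ccontr)
    assume "\<not> ?thesis"
    then have "ereal (u n) \<le> ereal c" if "n \<ge> N" for n
      using k that by force
    then have "limsup (\<lambda>n. ereal (u n)) \<le> ereal c"
      by (intro Limsup_bounded eventually_sequentiallyI)
    then show False
      using c(2) by simp
  qed
  then show "\<exists>k. \<forall>N. \<exists>n\<ge>N. inverse (real (Suc k)) < u n" by blast
next
  assume "\<exists>k. \<forall>N. \<exists>n\<ge>N. inverse (real (Suc k)) < u n"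
  then obtain k where k: "\<And>N. \<exists>n\<ge>N. inverse (real (Suc k)) < u n" by blast
  show "0 < limsup (\<lambda>n. ereal (u n))"
  proof (rule ccontr)
    assume "\<not> 0 < limsup (\<lambda>n. ereal (u n))"
    then have "limsup (\<lambda>n. ereal (u n)) < ereal (inverse (real (Suc k)))"
      by (metis ereal_less(2) inverse_positive_iff_positive not_less of_nat_0_less_iff
          order_le_less_trans zero_less_Suc)
    then obtain N where "\<And>n. n \<ge> N \<Longrightarrow> u n < inverse (real (Suc k))"
      using Limsup_lessD by (fastforce simp: eventually_sequentially)
    then show False
      using k[of N] by force
  qed
qed

lemma (in Metric_space) mem_Li_Yorke_pairs_iff:
  "(x, y) \<in> Li_Yorke_pairs M d g \<longleftrightarrow>
     x \<in> M \<and> y \<in> M \<and>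
     (\<forall>k N. \<exists>n\<ge>N. d ((g ^^ n) x) ((g ^^ n) y) < inverse (real (Suc k))) \<and>
     (\<exists>k. \<forall>N. \<exists>n\<ge>N. inverse (real (Suc k)) < d ((g ^^ n) x) ((g ^^ n) y))"
  by (simp add: Li_Yorke_pairs_def liminf_nonneg_eq_0_iff limsup_pos_iff del: of_nat_Suc)

section \<open>Iterates of the map and of the induced map\<close>

lemma funpow_induced_map:
  fixes f :: "'a \<Rightarrow> 'a"
  shows "(induced_map f ^^ n) K = (f ^^ n) ` K"
  by (induction n) (auto simp: induced_map_def)

lemma funpow_maps_to:
  assumes "f \<in> X \<rightarrow> X"
  shows "(f ^^ n) \<in> X \<rightarrow> X"
  using assms by (induction n) auto

lemma continuous_on_funpow:
  assumes "continuous_on X f" "f \<in> X \<rightarrow> X"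
  shows "continuous_on X (f ^^ n)"
proof (induction n)
  case (Suc n)
  have "continuous_on ((f ^^ n) ` X) f"
    using assms(1) by (rule continuous_on_subset) (use funpow_maps_to[OF assms(2)] in auto)
  with Suc have "continuous_on X (f \<circ> (f ^^ n))"
    by (rule continuous_on_compose)
  then show ?case by simp
qed (simp add: id_def)

lemma image_funpow_in_compact_hyperspace:
  assumes "continuous_on X f" "f \<in> X \<rightarrow> X" "K \<in> compact_hyperspace X"
  shows "(f ^^ n) ` K \<in> compact_hyperspace X"
  using induced_map_in_compact_hyperspace[OF continuous_on_funpow funpow_maps_to, OF assms(1,2,2,3)]
  by (simp add: induced_map_def)

lemma continuous_on_dist_funpow:
  assumes "continuous_on X f" "f \<in> X \<rightarrow> X"
  shows "continuous_on (X \<times> X) (\<lambda>z. dist ((f ^^ n) (fst z)) ((f ^^ n) (snd z)))"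
  by (intro continuous_on_dist continuous_on_compose2[OF continuous_on_funpow[OF assms]]
      continuous_on_fst continuous_on_snd continuous_on_id) auto

text \<open>These are the sets \<open>F k N\<close> of the opening explanation; the weak inequality
  makes them closed.\<close>

definition eventually_close_pairs ::
  "'a::metric_space set \<Rightarrow> ('a \<Rightarrow> 'a) \<Rightarrow> nat \<Rightarrow> nat \<Rightarrow> ('a \<times> 'a) set" where
  "eventually_close_pairs X f k N =
     {z \<in> X \<times> X. \<forall>n\<ge>N. dist ((f ^^ n) (fst z)) ((f ^^ n) (snd z)) \<le> inverse (real (Suc k))}"

text \<open>The union over all \<open>k\<close> and \<open>N\<close> is the set of non-proximal
  pairs.\<close>

definition eventually_apart_pairs ::
  "'a::metric_space set \<Rightarrow> ('a \<Rightarrow> 'a) \<Rightarrow> nat \<Rightarrow> nat \<Rightarrow> ('a \<times> 'a) set" where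
  "eventually_apart_pairs X f k N =
     {z \<in> X \<times> X. \<forall>n\<ge>N. inverse (real (Suc k)) \<le> dist ((f ^^ n) (fst z)) ((f ^^ n) (snd z))}"

lemma closedin_eventually_close_pairs:
  assumes "continuous_on X f" "f \<in> X \<rightarrow> X"
  shows "closedin (top_of_set (X \<times> X)) (eventually_close_pairs X f k N)"
proof -
  have "closedin (top_of_set (X \<times> X))
      (\<Inter>n\<in>{N..}. X \<times> X \<inter>
         (\<lambda>z. dist ((f ^^ n) (fst z)) ((f ^^ n) (snd z))) -` {..inverse (real (Suc k))})"
    by (intro closedin_INT continuous_closedin_preimage continuous_on_dist_funpow[OF assms]) auto
  also have "\<dots> = eventually_close_pairs X f k N"
    unfolding eventually_close_pairs_def by fastforce
  finally show ?thesis .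
qed

lemma closedin_eventually_apart_pairs:
  assumes "continuous_on X f" "f \<in> X \<rightarrow> X"
  shows "closedin (top_of_set (X \<times> X)) (eventually_apart_pairs X f k N)"
proof -
  have "closedin (top_of_set (X \<times> X))
      (\<Inter>n\<in>{N..}. X \<times> X \<inter>
         (\<lambda>z. dist ((f ^^ n) (fst z)) ((f ^^ n) (snd z))) -` {inverse (real (Suc k))..})"
    by (intro closedin_INT continuous_closedin_preimage continuous_on_dist_funpow[OF assms]) auto
  also have "\<dots> = eventually_apart_pairs X f k N"
    unfolding eventually_apart_pairs_def by fastforce
  finally show ?thesis .
qed

text \<open>De Morgan's laws for \<open>mem_Li_Yorke_pairs_iff\<close>: failure of the condition on
  the limit inferior gives the union, failure of that on the limit superior gives the
  intersection.\<close>

lemma Compl_Li_Yorke_pairs: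
  fixes X :: "'a::metric_space set"
  shows "X \<times> X - Li_Yorke_pairs X dist f =
    (\<Union>k N. eventually_apart_pairs X f k N) \<union> (\<Inter>k. \<Union>N. eventually_close_pairs X f k N)"
proof -
  interpret Submetric UNIV dist X
    by unfold_locales auto
  have "z \<in> X \<times> X - Li_Yorke_pairs X dist f \<longleftrightarrow>
      z \<in> (\<Union>k N. eventually_apart_pairs X f k N) \<union> (\<Inter>k. \<Union>N. eventually_close_pairs X f k N)" for z
    by (cases z)
      (auto simp: sub.mem_Li_Yorke_pairs_iff eventually_apart_pairs_def eventually_close_pairs_def
        not_less simp del: of_nat_Suc)
  then show ?thesis by blast
qed

text \<open>For each \<open>k\<close> the interiors form an open cover of the compact set
  \<open>K \<times> L\<close>. A finite subcover gives one time from which all its point pairs are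
  within \<open>inverse (real (Suc k))\<close>, so the Hausdorff distances of the images tend to
  0.\<close>

lemma hyperspace_box_Li_Yorke_disjoint:
  assumes "continuous_on X f" "f \<in> X \<rightarrow> X"
    and KL: "\<And>k. (K, L) \<in> hyperspace_box X
      (\<Union>N. top_of_set (X \<times> X) interior_of eventually_close_pairs X f k N)"
  shows "(K, L) \<notin> Li_Yorke_pairs (compact_hyperspace X) hausdorff_dist (induced_map f)"
proof -
  interpret Metric_space "compact_hyperspace X" hausdorff_dist
    by (rule Metric_space_compact_hyperspace)
  let ?I = "\<lambda>k N. top_of_set (X \<times> X) interior_of eventually_close_pairs X f k N"
  have K: "K \<in> compact_hyperspace X" and L: "L \<in> compact_hyperspace X"
    using KL[of 0] by (auto simp: hyperspace_box_def)
  have "\<exists>N. \<forall>n\<ge>N. hausdorff_dist ((f ^^ n) ` K) ((f ^^ n) ` L) \<le> inverse (real (Suc k))" for k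
  proof -
    have "compactin (top_of_set (X \<times> X)) (K \<times> L)"
      using compact_hyperspaceD(2,3)[OF K] compact_hyperspaceD(2,3)[OF L]
      by (simp add: compactin_subtopology compact_Times Sigma_mono)
    moreover have "K \<times> L \<subseteq> \<Union>(range (?I k))"
      using KL[of k] by (simp add: hyperspace_box_def)
    moreover have "openin (top_of_set (X \<times> X)) U" if "U \<in> range (?I k)" for U
      using that by auto
    ultimately obtain \<F> where "finite \<F>" "\<F> \<subseteq> range (?I k)" and sub: "K \<times> L \<subseteq> \<Union>\<F>"
      using compactinD[of _ "K \<times> L" "range (?I k)"] by metis
    then obtain J where J: "finite J" "\<F> = ?I k ` J"
      by (meson finite_subset_image)
    \<comment> \<open>Inserting 0 makes the maximum meaningful without checking that
      \<open>J\<close> is non-empty.\<close>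
    define N where "N = Max (insert 0 J)"
    have "dist ((f ^^ n) x) ((f ^^ n) y) \<le> inverse (real (Suc k))"
      if xy: "x \<in> K" "y \<in> L" and n: "n \<ge> N" for x y n
    proof -
      obtain j where j: "j \<in> J" "(x, y) \<in> ?I k j"
        using xy sub J(2) by blast
      then have "(x, y) \<in> eventually_close_pairs X f k j"
        using interior_of_subset by (metis subsetD)
      moreover have "j \<le> n"
        using j(1) J(1) n by (auto simp: N_def)
      ultimately show ?thesis
        by (simp add: eventually_close_pairs_def)
    qed
    then have "hausdorff_dist ((f ^^ n) ` K) ((f ^^ n) ` L) \<le> inverse (real (Suc k))"
      if "n \<ge> N" for n
    proof (intro hausdorff_dist_le)
      \<comment> \<open>All pairs in \<open>K \<times> L\<close> are close at time \<open>n\<close>,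
        so one fixed partner from the other set bounds every \<open>infdist\<close>.\<close>
      obtain x0 y0 where x0: "x0 \<in> K" and y0: "y0 \<in> L"
        using K L compact_hyperspaceD(1) by blast
      assume *: "\<And>x y n. x \<in> K \<Longrightarrow> y \<in> L \<Longrightarrow> n \<ge> N \<Longrightarrow>
        dist ((f ^^ n) x) ((f ^^ n) y) \<le> inverse (real (Suc k))"
      show "infdist a ((f ^^ n) ` L) \<le> inverse (real (Suc k))" if "a \<in> (f ^^ n) ` K" for a
        using that y0 *[OF _ y0 \<open>n \<ge> N\<close>] by (auto intro!: infdist_le2[OF imageI[OF y0]])
      show "infdist b ((f ^^ n) ` K) \<le> inverse (real (Suc k))" if "b \<in> (f ^^ n) ` L" for b
        using that x0 *[OF x0 _ \<open>n \<ge> N\<close>]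
        by (auto simp: dist_commute intro!: infdist_le2[OF imageI[OF x0]])
    qed (use compact_hyperspaceD(1)[OF K] compact_hyperspaceD(1)[OF L] in auto)
    then show ?thesis by blast
  qed
  then show ?thesis
    unfolding mem_Li_Yorke_pairs_iff funpow_induced_map by (meson not_less)
qed

section \<open>Generic chaos passes from the induced map to the map\<close>

lemma generically_chaotic_if_induced_map:
  fixes X :: "'a::metric_space set"
  assumes "compact X" and f: "continuous_on X f" "f \<in> X \<rightarrow> X"
    and chaotic: "generically_chaotic (compact_hyperspace X) hausdorff_dist (induced_map f)"
  shows "generically_chaotic X dist f"
proof -
  interpret H: Metric_space "compact_hyperspace X" hausdorff_dist
    by (rule Metric_space_compact_hyperspace)
  let ?T = "top_of_set (X \<times> X)"
  let ?LY = "Li_Yorke_pairs (compact_hyperspace X) hausdorff_dist (induced_map f)"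
  note compl = completely_metrizable_hyperspace_prod[OF \<open>compact X\<close>]
  have residual: "residual_in (hyperspace_prod X) ?LY"
    using chaotic by (simp add: generically_chaotic_def)
  have "?T interior_of eventually_apart_pairs X f k N = {}" for k N
  proof (rule ccontr)
    let ?W = "?T interior_of eventually_apart_pairs X f k N"
    assume W: "?W \<noteq> {}"
    have "openin ?T ?W" by simp
    \<comment> \<open>By the Baire property the residual set of Li-Yorke pairs meets every non-empty
      open set, here the box over \<open>?W\<close>.\<close>
    then obtain K L where KL: "(K, L) \<in> ?LY" "(K, L) \<in> hyperspace_box X ?W"
      using residual_in_meets_openin[OF compl residual openin_hyperspace_box
          hyperspace_box_nonempty[OF _ W]] by fast
    then have K: "K \<in> compact_hyperspace X" and L: "L \<in> compact_hyperspace X"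
      by (auto simp: hyperspace_box_def)
    obtain n where n: "n \<ge> N"
      "hausdorff_dist ((f ^^ n) ` K) ((f ^^ n) ` L) < inverse (real (Suc k))"
      using KL(1) unfolding H.mem_Li_Yorke_pairs_iff funpow_induced_map by blast
    \<comment> \<open>Any point of \<open>K\<close> will do: at time \<open>n\<close> the images are
      Hausdorff-close, so some \<open>y \<in> L\<close> comes too close to it for a pair in
      \<open>?W\<close>.\<close>
    obtain x where x: "x \<in> K"
      using compact_hyperspaceD(1)[OF K] by blast
    obtain y where y: "y \<in> L" "dist ((f ^^ n) x) ((f ^^ n) y) < inverse (real (Suc k))"
      using hausdorff_dist_lessE[OF image_funpow_in_compact_hyperspace[OF f K]
          image_funpow_in_compact_hyperspace[OF f L] n(2) imageI[OF x]] by blast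
    have "(x, y) \<in> eventually_apart_pairs X f k N"
      using KL(2) x y(1) interior_of_subset by (fastforce simp: hyperspace_box_def)
    then show False
      using y(2) n(1) by (force simp: eventually_apart_pairs_def)
  qed
  then have "first_category_in ?T (\<Union>k N. eventually_apart_pairs X f k N)"
    by (intro first_category_in_UN nowhere_dense_imp_first_category)
      (simp_all add: nowhere_dense_in_closedin closedin_eventually_apart_pairs[OF f])
  moreover have "first_category_in ?T (\<Inter>k. \<Union>N. eventually_close_pairs X f k N)"
  proof (rule first_category_in_INT_UN_closedin[OF closedin_eventually_close_pairs[OF f]], rule ccontr)
    let ?G = "\<lambda>k. \<Union>N. ?T interior_of eventually_close_pairs X f k N"
    \<comment> \<open>If \<open>?W\<close> is non-empty, every \<open>?G k\<close> is dense in it,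
      and this density carries over to the boxes.\<close>
    let ?W = "?T interior_of (\<Inter>k. ?T closure_of ?G k)"
    assume W: "?W \<noteq> {}"
    have G: "openin ?T (?G k)" for k by auto
    have "?W \<subseteq> ?T closure_of ?G k" for k
      using interior_of_subset[of ?T "\<Inter>k. ?T closure_of ?G k"] by blast
    then have "first_category_in (hyperspace_prod X) (hyperspace_box X ?W - hyperspace_box X (?G k))"
      for k
      using G by (intro nowhere_dense_imp_first_category nowhere_dense_in_Diff_dense_open
          openin_hyperspace_box hyperspace_box_subset_closure_of) auto
    then have "first_category_in (hyperspace_prod X)
        ((topspace (hyperspace_prod X) - ?LY) \<union> (\<Union>k. hyperspace_box X ?W - hyperspace_box X (?G k)))"
      using residual by (intro first_category_in_Un first_category_in_UN) (auto simp: residual_in_def)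
    \<comment> \<open>A pair that misses all the differences lies in the box over every
      \<open>?G k\<close>, so it is asymptotic and not Li-Yorke. The whole open box is thus of first
      category, against the Baire category theorem.\<close>
    moreover have "hyperspace_box X ?W \<subseteq>
        (topspace (hyperspace_prod X) - ?LY) \<union> (\<Union>k. hyperspace_box X ?W - hyperspace_box X (?G k))"
    proof
      fix P assume P: "P \<in> hyperspace_box X ?W"
      then have top: "P \<in> topspace (hyperspace_prod X)"
        unfolding topspace_hyperspace_prod hyperspace_box_def by blast
      have "P \<notin> ?LY" if "\<And>k. P \<in> hyperspace_box X (?G k)"
        using hyperspace_box_Li_Yorke_disjoint[OF f, of "fst P" "snd P"] that by simp
      then show "P \<in> (topspace (hyperspace_prod X) - ?LY) \<union>
          (\<Union>k. hyperspace_box X ?W - hyperspace_box X (?G k))"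
        using P top by blast
    qed
    ultimately have "first_category_in (hyperspace_prod X) (hyperspace_box X ?W)"
      by (rule first_category_in_subset)
    then show False
      using openin_not_first_category[OF compl openin_hyperspace_box hyperspace_box_nonempty] W
      by simp
  qed
  ultimately have "first_category_in ?T (X \<times> X - Li_Yorke_pairs X dist f)"
    unfolding Compl_Li_Yorke_pairs by (rule first_category_in_Un)
  then show ?thesis
    unfolding generically_chaotic_def residual_in_def
    by (auto simp: mtopology_dist Li_Yorke_pairs_def)
qed

theorem theorem2p1:
  fixes f :: "real \<Rightarrow> real"
  assumes "continuous_on {0..1} f"
    and "f \<in> {0..1} \<rightarrow> {0..1}"
    and "generically_chaotic (compact_hyperspace {0..1}) hausdorff_dist (induced_map f)"
  shows "generically_chaotic {0..1} dist f"
  using compact_Icc assms by (rule generically_chaotic_if_induced_map)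

end
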